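(* Let $1\le k\le n$ be integers and let $t\in(0,1)$ be fixed (nonrandom). Suppose that $(p_i,H_i)$, $i=1,\ldots,n$, are i.i.d. as $(p,H)$, where $H\in\{0,1\}$, $\Pr(H=0)=\pi_0=1-\Pr(H=1)$, and $\Pr(p\le u\mid H)=(1-H)u+HF_1(u)$ for $u\in(0,1)$, for some cdf $F_1$. Then the $k$-FDR of the single-step test that rejects each $H_i=0$ if and only if $p_i\le t$ is given by $$k\text{-FDR}_n(t)=n\pi_0 t\,E\left\{\frac{I[V_{n-1}(t)\ge k-1]}{R_{n-1}(t)+1}\right\}.$$
   Context: There are $n$ null hypotheses; $H_i=0$ means the $i$th null hypothesis is true and $H_i=1$ means it is false; $p_i$ is a $p$-value (taking values in $[0,1]$) for the $i$th null hypothesis. $I(A)$ (or $I[A]$) is the indicator of the event $A$. For every integer $m\ge 0$, with $(p_i,H_i)$ i.i.d. from the model, $$V_m(t)=\sum_{i=1}^m I(p_i\le t,\,H_i=0),\qquad R_m(t)=\sum_{i=1}^m I(p_i\le t),$$ so that $V_{n-1}(t),R_{n-1}(t)$ are the analogous counts based on $n-1$ of the pairs $(p_i,H_i)$. The $k$-FDR of the single-step test is $$k\text{-FDR}_n(t)=E\left\{\frac{V_n(t)\,I(V_n(t)\ge k)}{\max(R_n(t),1)}\right\}.$$ *)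

theory Defs
  imports "HOL-Probability.Probability"
begin

(* A version of the conditional probability of the event P given the random variable H, that is,
   given the sigma-algebra generated by H; it is determined only up to null sets.  H has to be
   measurable: for a sigma-algebra that is not a subalgebra of M, real_cond_exp is 0. *)
definition cond_prob_given ::
    "'a measure \<Rightarrow> ('a \<Rightarrow> bool) \<Rightarrow> ('a \<Rightarrow> nat) \<Rightarrow> 'a \<Rightarrow> real" where
  "cond_prob_given M P H =
     real_cond_exp M (vimage_algebra (space M) H (count_space UNIV))
       (indicator {\<omega> \<in> space M. P \<omega>})"

definition is_cdf :: "(real \<Rightarrow> real) \<Rightarrow> bool" where
  "is_cdf F \<longleftrightarrow> (\<exists>\<nu>. real_distribution \<nu> \<and> F = cdf \<nu>)"

(* H i \<omega> = 0 means that the i-th null hypothesis is true; indices start at 1. *)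

definition V :: "(nat \<Rightarrow> 'a \<Rightarrow> real) \<Rightarrow> (nat \<Rightarrow> 'a \<Rightarrow> nat) \<Rightarrow> nat \<Rightarrow> real \<Rightarrow> 'a \<Rightarrow> nat" where
  "V p H m t \<omega> = (\<Sum>i=1..m. of_bool (p i \<omega> \<le> t \<and> H i \<omega> = 0))"

definition R :: "(nat \<Rightarrow> 'a \<Rightarrow> real) \<Rightarrow> nat \<Rightarrow> real \<Rightarrow> 'a \<Rightarrow> nat" where
  "R p m t \<omega> = (\<Sum>i=1..m. of_bool (p i \<omega> \<le> t))"

definition k_FDR ::
    "'a measure \<Rightarrow> (nat \<Rightarrow> 'a \<Rightarrow> real) \<Rightarrow> (nat \<Rightarrow> 'a \<Rightarrow> nat) \<Rightarrow> nat \<Rightarrow> nat \<Rightarrow> real \<Rightarrow> real" where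
  "k_FDR M p H k n t =
     (\<integral>\<omega>. real (V p H n t \<omega>) * of_bool (V p H n t \<omega> \<ge> k) / real (max (R p n t \<omega>) 1) \<partial>M)"

end

theory Submission
  imports Defs
begin

text \<open>
  If the \<open>i\<close>-th hypothesis is a rejected true null, then \<open>V\<^sub>n\<close> and \<open>R\<^sub>n\<close> exceed by one the counts
  over the other \<open>n - 1\<close> indices. So the integrand of the \<open>k\<close>-FDR is the sum over \<open>i\<close> of the
  indicator of that event times a function of the other pairs. These factors are independent; the
  first has expectation \<open>\<pi>\<^sub>0 t\<close>, and as the pairs are i.i.d., the expectation of the second does
  not depend on which index is left out.
\<close>

text \<open>Injectivity makes the singleton blocks \<open>{h j}\<close> pairwise disjoint, so
  grouping an independent family into these blocks keeps independence; evaluating block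
  \<open>j\<close> at its only coordinate recovers \<open>X (h j)\<close>.\<close>

lemma (in prob_space) indep_vars_reindex_inj:
  assumes "indep_vars (\<lambda>_. S) X I" and "inj_on h J" and "h ` J \<subseteq> I"
  shows "indep_vars (\<lambda>_. S) (\<lambda>j. X (h j)) J"
proof -
  have "indep_vars (\<lambda>j. PiM {h j} (\<lambda>_. S)) (\<lambda>j \<omega>. restrict (\<lambda>i. X i \<omega>) {h j}) J"
    using assms by (intro indep_vars_restrict) (auto simp: disjoint_family_on_def dest: inj_onD)
  then have "indep_vars (\<lambda>_. S) (\<lambda>j \<omega>. (restrict (\<lambda>i. X i \<omega>) {h j}) (h j)) J"
    by (rule indep_vars_compose2[where Y = "\<lambda>j x. x (h j)"]) simp
  then show ?thesis by simp
qed

text \<open>Both sides equal the product measure with every factor \<open>D\<close>: distinct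
  members of an i.i.d. family have the same joint law, whichever members are picked.\<close>

lemma (in prob_space) distr_iid_reindex:
  assumes ind: "indep_vars (\<lambda>_. S) X I"
    and ident: "\<And>i. i \<in> I \<Longrightarrow> distr M S (X i) = D"
    and "inj_on h J" and "h ` J \<subseteq> I" and "J \<subseteq> I"
  shows "distr M (PiM J (\<lambda>_. S)) (\<lambda>\<omega>. \<lambda>j\<in>J. X (h j) \<omega>)
       = distr M (PiM J (\<lambda>_. S)) (\<lambda>\<omega>. \<lambda>j\<in>J. X j \<omega>)"
\<comment> \<open>The product characterisation of independence needs a nonempty index set. For empty
  \<open>J\<close> both families are the same constant function.\<close>
proof (cases "J = {}")
  case False
  have law: "distr M (PiM J (\<lambda>_. S)) (\<lambda>\<omega>. \<lambda>j\<in>J. X (g j) \<omega>) = PiM J (\<lambda>_. D)"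
    if g: "inj_on g J" "g ` J \<subseteq> I" for g
  proof -
    have *: "indep_vars (\<lambda>_. S) (\<lambda>j. X (g j)) J"
      using indep_vars_reindex_inj[OF ind g] .
    then have "random_variable S (X (g j))" if "j \<in> J" for j
      using that by (simp add: indep_vars_def)
    with * have "distr M (PiM J (\<lambda>_. S)) (\<lambda>\<omega>. \<lambda>j\<in>J. X (g j) \<omega>) = PiM J (\<lambda>j. distr M S (X (g j)))"
      using indep_vars_iff_distr_eq_PiM'[OF False, where M' = "\<lambda>_. S"] by simp
    also have "\<dots> = PiM J (\<lambda>_. D)"
      using g ident by (intro PiM_cong) auto
    finally show ?thesis .
  qed
  show ?thesis
    using law[of h] law[of "\<lambda>j. j"] assms by simp
qed (simp cong: restrict_cong add: restrict_def)

text \<open>The factor with \<open>f\<close> depends only on block \<open>{i}\<close> and the factor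
  with \<open>G\<close> only on block \<open>I - {i}\<close>, so they are independent and the
  expectation factorises. Replacing the enumeration \<open>h\<close> by the identity on
  \<open>J\<close> removes \<open>i\<close> from the result.\<close>

lemma (in prob_space) iid_leave_one_out:
  fixes f :: "'c \<Rightarrow> real" and G :: "('i \<Rightarrow> 'c) \<Rightarrow> real"
  assumes ind: "indep_vars (\<lambda>_. S) X I"
    and ident: "\<And>i. i \<in> I \<Longrightarrow> distr M S (X i) = D"
    and i: "i \<in> I" and h: "inj_on h J" "h ` J \<subseteq> I - {i}" and J: "J \<subseteq> I"
    and f[measurable]: "f \<in> borel_measurable S" and bf: "\<And>x. \<bar>f x\<bar> \<le> B"
    and G[measurable]: "G \<in> borel_measurable (PiM J (\<lambda>_. S))" and bG: "\<And>x. \<bar>G x\<bar> \<le> C"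
  shows "(\<integral>\<omega>. f (X i \<omega>) * G (\<lambda>j\<in>J. X (h j) \<omega>) \<partial>M)
       = (\<integral>x. f x \<partial>D) * (\<integral>\<omega>. G (\<lambda>j\<in>J. X j \<omega>) \<partial>M)"
    and "integrable M (\<lambda>\<omega>. f (X i \<omega>) * G (\<lambda>j\<in>J. X (h j) \<omega>))"
proof -
  have X: "X j \<in> measurable M S" if "j \<in> I" for j
    using ind that by (auto simp: indep_vars_def)
  have Xi[measurable]: "X i \<in> measurable M S"
    using X i .
  have Xh[measurable]: "(\<lambda>\<omega>. \<lambda>j\<in>J. X (h j) \<omega>) \<in> measurable M (PiM J (\<lambda>_. S))"
    using h by (intro measurable_restrict X) auto
  have XJ[measurable]: "(\<lambda>\<omega>. \<lambda>j\<in>J. X j \<omega>) \<in> measurable M (PiM J (\<lambda>_. S))"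
    using J by (intro measurable_restrict X) auto
  have "indep_var borel ((\<lambda>x. f (x i)) \<circ> (\<lambda>\<omega>. restrict (\<lambda>i. X i \<omega>) {i}))
      borel ((\<lambda>x. G (\<lambda>j\<in>J. x (h j))) \<circ> (\<lambda>\<omega>. restrict (\<lambda>i. X i \<omega>) (I - {i})))"
  proof (rule indep_var_compose[OF indep_var_restrict[OF ind]])
    have "(\<lambda>x. \<lambda>j\<in>J. x (h j)) \<in> measurable (PiM (I - {i}) (\<lambda>_. S)) (PiM J (\<lambda>_. S))"
      using h by (intro measurable_restrict measurable_component_singleton) auto
    then show "(\<lambda>x. G (\<lambda>j\<in>J. x (h j))) \<in> borel_measurable (PiM (I - {i}) (\<lambda>_. S))"
      by measurable
  qed (use i in auto)
  also have "(\<lambda>x. f (x i)) \<circ> (\<lambda>\<omega>. restrict (\<lambda>i. X i \<omega>) {i}) = (\<lambda>\<omega>. f (X i \<omega>))"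
    by auto
  also have "(\<lambda>x. G (\<lambda>j\<in>J. x (h j))) \<circ> (\<lambda>\<omega>. restrict (\<lambda>i. X i \<omega>) (I - {i}))
      = (\<lambda>\<omega>. G (\<lambda>j\<in>J. X (h j) \<omega>))"
  \<comment> \<open>All values \<open>h j\<close> lie in \<open>I - {i}\<close>, so restricting the
    family to that block changes nothing that \<open>G\<close> sees.\<close>
  proof (rule ext, unfold o_def, rule arg_cong[where f = G])
    show "(\<lambda>j\<in>J. restrict (\<lambda>i. X i \<omega>) (I - {i}) (h j)) = (\<lambda>j\<in>J. X (h j) \<omega>)" for \<omega>
      using h by (intro restrict_ext) auto
  qed
  finally have iv: "indep_var borel (\<lambda>\<omega>. f (X i \<omega>)) borel (\<lambda>\<omega>. G (\<lambda>j\<in>J. X (h j) \<omega>))" .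
  have int: "integrable M (\<lambda>\<omega>. f (X i \<omega>))" "integrable M (\<lambda>\<omega>. G (\<lambda>j\<in>J. X (h j) \<omega>))"
    by (rule integrable_const_bound[where B = B], use bf in simp, measurable)
      (rule integrable_const_bound[where B = C], use bG in simp, measurable)
  show "integrable M (\<lambda>\<omega>. f (X i \<omega>) * G (\<lambda>j\<in>J. X (h j) \<omega>))"
    using indep_var_integrable[OF iv int] .
  have "(\<integral>\<omega>. f (X i \<omega>) \<partial>M) = (\<integral>x. f x \<partial>distr M S (X i))"
    by (rule integral_distr[symmetric]) measurable
  moreover have "(\<integral>\<omega>. G (\<lambda>j\<in>J. X (h j) \<omega>) \<partial>M) = (\<integral>\<omega>. G (\<lambda>j\<in>J. X j \<omega>) \<partial>M)"
  \<comment> \<open>The two integrands may differ pointwise; only the laws of their arguments agree,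
    so both integrals are moved to the law on \<open>PiM J\<close>.\<close>
  proof -
    have "(\<integral>\<omega>. G (\<lambda>j\<in>J. X (h j) \<omega>) \<partial>M)
        = (\<integral>x. G x \<partial>distr M (PiM J (\<lambda>_. S)) (\<lambda>\<omega>. \<lambda>j\<in>J. X (h j) \<omega>))"
      by (rule integral_distr[symmetric]) measurable
    also have "\<dots> = (\<integral>x. G x \<partial>distr M (PiM J (\<lambda>_. S)) (\<lambda>\<omega>. \<lambda>j\<in>J. X j \<omega>))"
      using h(2) by (subst distr_iid_reindex[OF ind ident h(1) _ J]) auto
    also have "\<dots> = (\<integral>\<omega>. G (\<lambda>j\<in>J. X j \<omega>) \<partial>M)"
      by (rule integral_distr) measurable
    finally show ?thesis .
  qed
  ultimately show "(\<integral>\<omega>. f (X i \<omega>) * G (\<lambda>j\<in>J. X (h j) \<omega>) \<partial>M)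
       = (\<integral>x. f x \<partial>D) * (\<integral>\<omega>. G (\<lambda>j\<in>J. X j \<omega>) \<partial>M)"
    using indep_var_lebesgue_integral[OF iv int] ident[OF i] by simp
qed

text \<open>The event \<open>H = h\<close> belongs to the sigma-algebra generated by
  \<open>H\<close>, so integrating the conditional probability over it gives the joint probability;
  there the integrand is almost surely \<open>c\<close>.\<close>

lemma (in prob_space) prob_inter_of_cond_prob_given:
  assumes P[measurable]: "{\<omega> \<in> space M. P \<omega>} \<in> events"
    and H[measurable]: "H \<in> measurable M (count_space UNIV)"
    and c: "AE \<omega> in M. H \<omega> = h \<longrightarrow> cond_prob_given M P H \<omega> = c"
  shows "\<P>(\<omega> in M. P \<omega> \<and> H \<omega> = h) = c * \<P>(\<omega> in M. H \<omega> = h)"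
proof -
  let ?F = "vimage_algebra (space M) H (count_space UNIV)"
  \<comment> \<open>Measurability of \<open>H\<close> enters here: it excludes the case in which
    \<open>real_cond_exp\<close> takes its default value 0.\<close>
  have "subalgebra M ?F"
    unfolding subalgebra_def using sets_image_in_sets[OF refl H] by simp
  then interpret F: finite_measure_subalgebra M ?F
    by unfold_locales
  let ?A = "{\<omega> \<in> space M. H \<omega> = h}" and ?B = "{\<omega> \<in> space M. P \<omega>}"
  have "?A = H -` {h} \<inter> space M"
    by auto
  then have A: "?A \<in> sets ?F"
    using in_vimage_algebra[of "{h}" "count_space UNIV" H "space M"] by simp
  have "\<P>(\<omega> in M. P \<omega> \<and> H \<omega> = h) = (\<integral>\<omega>. indicator {\<omega> \<in> space M. P \<omega> \<and> H \<omega> = h} \<omega> \<partial>M)"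
    by (simp add: Int_absorb2 Collect_restrict)
  also have "\<dots> = (\<integral>\<omega>\<in>?A. indicator ?B \<omega> \<partial>M)"
    unfolding set_lebesgue_integral_def
    by (rule Bochner_Integration.integral_cong) (auto simp: indicator_def)
  also have "\<dots> = (\<integral>\<omega>\<in>?A. cond_prob_given M P H \<omega> \<partial>M)"
    unfolding cond_prob_given_def
    by (rule F.real_cond_exp_intA[OF _ A]) (simp add: integrable_indicator_iff P emeasure_eq_measure)
  also have "\<dots> = (\<integral>\<omega>. c * indicator ?A \<omega> \<partial>M)"
    unfolding set_lebesgue_integral_def
  proof (rule integral_cong_AE)
    show "AE \<omega> in M. indicator ?A \<omega> *\<^sub>R cond_prob_given M P H \<omega> = c * indicator ?A \<omega>"
      using c by eventually_elim (auto simp: indicator_def)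
  qed (simp_all add: cond_prob_given_def)
  also have "\<dots> = c * \<P>(\<omega> in M. H \<omega> = h)"
    by (simp add: Int_absorb2 Collect_restrict)
  finally show ?thesis .
qed

text \<open>If \<open>a i\<close> holds, so does \<open>b i\<close>, and leaving out
  \<open>i\<close> lowers both counts by exactly one; the denominator is then positive and the
  \<open>max\<close> has no effect. If \<open>a i\<close> fails, the term vanishes. Hence each term
  is \<open>a i\<close> times one common ratio, and summing restores the factor
  \<open>?V\<close>.\<close>

lemma fdp_leave_one_out:
  fixes a b :: "'i \<Rightarrow> bool" and k :: nat
  assumes "finite I" and "1 \<le> k" and ab: "\<And>i. a i \<Longrightarrow> b i"
  shows "real (\<Sum>i\<in>I. of_bool (a i)) * of_bool ((\<Sum>i\<in>I. of_bool (a i)) \<ge> k)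
           / real (max (\<Sum>i\<in>I. of_bool (b i)) 1)
       = (\<Sum>i\<in>I. of_bool (a i) * (of_bool ((\<Sum>j\<in>I - {i}. of_bool (a j)) \<ge> k - 1)
           / (real (\<Sum>j\<in>I - {i}. of_bool (b j)) + 1)))"
    (is "real ?V * of_bool (?V \<ge> k) / real (max ?R 1) = (\<Sum>i\<in>I. ?term i)")
proof -
  have "?term i = of_bool (a i) * (of_bool (?V \<ge> k) / real (max ?R 1))" if "i \<in> I" for i
  proof (cases "a i")
    case True
    have "?V = Suc (\<Sum>j\<in>I - {i}. of_bool (a j))" "?R = Suc (\<Sum>j\<in>I - {i}. of_bool (b j))"
      using True ab[of i] by (simp_all only: sum.remove[OF \<open>finite I\<close> that] of_bool_eq plus_1_eq_Suc)
    moreover have "of_bool (v \<ge> k - 1) / (real r + 1) = of_bool (Suc v \<ge> k) / real (max (Suc r) 1)"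
      for v r
      using \<open>1 \<le> k\<close> by (auto simp: of_bool_def)
    ultimately show ?thesis by (simp only:)
  qed simp
  then have "(\<Sum>i\<in>I. ?term i)
      = (\<Sum>i\<in>I. of_bool (a i) * (of_bool (?V \<ge> k) / real (max ?R 1)))"
    by (rule sum.cong[OF refl])
  also have "\<dots> = (\<Sum>i\<in>I. of_bool (a i)) * (of_bool (?V \<ge> k) / real (max ?R 1))"
    by (rule sum_distrib_right[symmetric])
  also have "\<dots> = real ?V * of_bool (?V \<ge> k) / real (max ?R 1)"
    by (simp only: of_nat_sum of_nat_of_bool times_divide_eq_right)
  finally show ?thesis by (rule sym)
qed

theorem theorem2p1:
  fixes M :: "'a measure" and N :: "'b measure"
    and p :: "nat \<Rightarrow> 'a \<Rightarrow> real" and H :: "nat \<Rightarrow> 'a \<Rightarrow> nat"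
    and p0 :: "'b \<Rightarrow> real" and H0 :: "'b \<Rightarrow> nat"
    and \<pi>\<^sub>0 t :: real and F\<^sub>1 :: "real \<Rightarrow> real" and k n :: nat
  assumes "1 \<le> k" and "k \<le> n" and "0 < t" and "t < 1"
    \<comment> \<open>the generic pair \<open>(p0, H0)\<close>\<close>
    and "prob_space N"
    and "p0 \<in> borel_measurable N" and "H0 \<in> measurable N (count_space UNIV)"
    and "\<And>\<omega>. \<omega> \<in> space N \<Longrightarrow> p0 \<omega> \<in> {0..1}" and "\<And>\<omega>. \<omega> \<in> space N \<Longrightarrow> H0 \<omega> \<in> {0, 1}"
    and "\<P>(\<omega> in N. H0 \<omega> = 0) = \<pi>\<^sub>0" and "\<pi>\<^sub>0 = 1 - \<P>(\<omega> in N. H0 \<omega> = 1)"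
    and "is_cdf F\<^sub>1"
    and "\<And>u. u \<in> {0<..<1} \<Longrightarrow>
           AE \<omega> in N. cond_prob_given N (\<lambda>\<omega>. p0 \<omega> \<le> u) H0 \<omega>
                      = (1 - real (H0 \<omega>)) * u + real (H0 \<omega>) * F\<^sub>1 u"
    \<comment> \<open>the pairs \<open>(p i, H i)\<close>, \<open>1 \<le> i \<le> n\<close>, are i.i.d. as \<open>(p0, H0)\<close>\<close>
    and "prob_space M"
    and "\<And>i \<omega>. i \<in> {1..n} \<Longrightarrow> \<omega> \<in> space M \<Longrightarrow> p i \<omega> \<in> {0..1}"
    and "\<And>i \<omega>. i \<in> {1..n} \<Longrightarrow> \<omega> \<in> space M \<Longrightarrow> H i \<omega> \<in> {0, 1}"
    and "prob_space.indep_vars M (\<lambda>_. borel \<Otimes>\<^sub>M count_space UNIV) (\<lambda>i \<omega>. (p i \<omega>, H i \<omega>)) {1..n}"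
    and "\<And>i. i \<in> {1..n} \<Longrightarrow>
           distr M (borel \<Otimes>\<^sub>M count_space UNIV) (\<lambda>\<omega>. (p i \<omega>, H i \<omega>))
         = distr N (borel \<Otimes>\<^sub>M count_space UNIV) (\<lambda>\<omega>. (p0 \<omega>, H0 \<omega>))"
  shows "k_FDR M p H k n t =
           real n * \<pi>\<^sub>0 * t *
             (\<integral>\<omega>. of_bool (V p H (n - 1) t \<omega> \<ge> k - 1) / (real (R p (n - 1) t \<omega>) + 1) \<partial>M)"
proof -
  interpret N: prob_space N by fact
  interpret M: prob_space M by fact
  note [measurable] = assms(6,7)
  define S :: "(real \<times> nat) measure" where "S = borel \<Otimes>\<^sub>M count_space UNIV"
  define D where "D = distr N S (\<lambda>\<omega>. (p0 \<omega>, H0 \<omega>))"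
  define X where "X = (\<lambda>i \<omega>. (p i \<omega>, H i \<omega>))"
  define J where "J = {1..n - 1}"
  \<comment> \<open>\<open>f\<close> marks a rejected true null. \<open>G\<close> is the integrand
    of the claimed formula, written as a function of \<open>n - 1\<close> pairs.\<close>
  define f :: "real \<times> nat \<Rightarrow> real" where "f x = of_bool (fst x \<le> t \<and> snd x = 0)" for x
  define G :: "(nat \<Rightarrow> real \<times> nat) \<Rightarrow> real" where
    "G x = of_bool ((\<Sum>j\<in>J. of_bool (fst (x j) \<le> t \<and> snd (x j) = 0)) \<ge> k - 1)
             / (real (\<Sum>j\<in>J. of_bool (fst (x j) \<le> t)) + 1)" for x
  have ind: "M.indep_vars (\<lambda>_. S) X {1..n}"
    using assms(17) by (simp add: S_def X_def)
  have ident: "distr M S (X i) = D" if "i \<in> {1..n}" for i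
    using assms(18)[OF that] by (simp add: S_def X_def D_def)
  have f[measurable]: "f \<in> borel_measurable S"
    unfolding f_def S_def by measurable
  \<comment> \<open>Coordinates are given with \<open>S\<close> unfolded, so that \<open>fst\<close>
    and \<open>snd\<close> of them are recognised as measurable.\<close>
  have [measurable]: "(\<lambda>x. x j) \<in> measurable (PiM J (\<lambda>_. S)) (borel \<Otimes>\<^sub>M count_space UNIV)"
    if "j \<in> J" for j
    using that by (simp add: S_def)
  have G: "G \<in> borel_measurable (PiM J (\<lambda>_. S))"
    unfolding G_def by measurable
  have "\<bar>f x\<bar> \<le> 1" for x
    by (simp add: f_def)
  moreover have "\<bar>G x\<bar> \<le> 1" for x
  proof -
    have "\<bar>of_bool P / (real m + 1)\<bar> \<le> 1" for P m
      by (cases P) simp_all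
    then show ?thesis
      unfolding G_def .
  qed
  ultimately have leave_out:
    "(\<integral>\<omega>. f (X i \<omega>) * G (\<lambda>j\<in>J. X (h j) \<omega>) \<partial>M)
       = (\<integral>x. f x \<partial>D) * (\<integral>\<omega>. G (\<lambda>j\<in>J. X j \<omega>) \<partial>M)"
    "integrable M (\<lambda>\<omega>. f (X i \<omega>) * G (\<lambda>j\<in>J. X (h j) \<omega>))"
    if "i \<in> {1..n}" "inj_on h J" "h ` J \<subseteq> {1..n} - {i}" "J \<subseteq> {1..n}" for i h
    using M.iid_leave_one_out[OF ind ident that f _ G, where B = 1 and C = 1]
    by blast+

  \<comment> \<open>On \<open>H0 = 0\<close> the model's conditional probability at
    \<open>u = t\<close> reduces to \<open>t\<close>, since the term with \<open>F\<^sub>1\<close>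
    has factor 0.\<close>
  have intf: "(\<integral>x. f x \<partial>D) = \<pi>\<^sub>0 * t"
  proof -
    have "(\<integral>x. f x \<partial>D) = (\<integral>\<omega>. f (p0 \<omega>, H0 \<omega>) \<partial>N)"
      unfolding D_def by (rule integral_distr) (simp_all add: S_def[symmetric] f, simp add: S_def)
    also have "\<dots> = (\<integral>\<omega>. indicator {\<omega> \<in> space N. p0 \<omega> \<le> t \<and> H0 \<omega> = 0} \<omega> \<partial>N)"
      by (rule Bochner_Integration.integral_cong) (auto simp: f_def indicator_def)
    also have "\<dots> = \<P>(\<omega> in N. p0 \<omega> \<le> t \<and> H0 \<omega> = 0)"
      by (simp add: Int_absorb2 Collect_restrict)
    also have "\<dots> = t * \<P>(\<omega> in N. H0 \<omega> = 0)"
    proof (rule N.prob_inter_of_cond_prob_given)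
      show "AE \<omega> in N. H0 \<omega> = 0 \<longrightarrow> cond_prob_given N (\<lambda>\<omega>. p0 \<omega> \<le> t) H0 \<omega> = t"
        using assms(13)[of t] \<open>0 < t\<close> \<open>t < 1\<close> by auto
    qed measurable
    finally show ?thesis
      using assms(10) by simp
  qed

  \<comment> \<open>Both sets have \<open>n - 1\<close> elements. Any bijection will do, because the
    counts inside \<open>G\<close> do not depend on the order of the pairs.\<close>
  have "\<exists>h. bij_betw h J ({1..n} - {i})" if "i \<in> {1..n}" for i
    using that by (intro finite_same_card_bij) (auto simp: J_def)
  then obtain h where h: "\<And>i. i \<in> {1..n} \<Longrightarrow> bij_betw (h i) J ({1..n} - {i})"
    by metis
  have h': "inj_on (h i) J" "h i ` J \<subseteq> {1..n} - {i}" if "i \<in> {1..n}" for i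
    using h[OF that] by (auto simp: bij_betw_def)
  have J: "J \<subseteq> {1..n}"
    by (auto simp: J_def)
  have GX: "G (\<lambda>j\<in>J. X (h i j) \<omega>) =
      of_bool ((\<Sum>j\<in>{1..n} - {i}. of_bool (p j \<omega> \<le> t \<and> H j \<omega> = 0)) \<ge> k - 1)
        / (real (\<Sum>j\<in>{1..n} - {i}. of_bool (p j \<omega> \<le> t)) + 1)" if "i \<in> {1..n}" for i \<omega>
    unfolding sum.reindex_bij_betw[OF h[OF that], symmetric] G_def X_def
    by (simp cong: sum.cong del: sum_of_bool_eq)
  \<comment> \<open>Pointwise decomposition by \<open>fdp_leave_one_out\<close>, with
    \<open>a\<close> the rejected true nulls and \<open>b\<close> all rejections; \<open>GX\<close>
    identifies the leave-one-out ratio with \<open>G\<close>.\<close>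
  have "k_FDR M p H k n t =
      (\<integral>\<omega>. (\<Sum>i\<in>{1..n}. f (X i \<omega>) * G (\<lambda>j\<in>J. X (h i j) \<omega>)) \<partial>M)"
    unfolding k_FDR_def V_def R_def
  proof (rule Bochner_Integration.integral_cong[OF refl], subst fdp_leave_one_out)
    fix \<omega>
    show "(\<Sum>i = 1..n. of_bool (p i \<omega> \<le> t \<and> H i \<omega> = 0) *
          (of_bool ((\<Sum>j\<in>{1..n} - {i}. of_bool (p j \<omega> \<le> t \<and> H j \<omega> = 0)) \<ge> k - 1)
            / (real (\<Sum>j\<in>{1..n} - {i}. of_bool (p j \<omega> \<le> t)) + 1)))
      = (\<Sum>i = 1..n. f (X i \<omega>) * G (\<lambda>j\<in>J. X (h i j) \<omega>))"
      by (rule sum.cong[OF refl]) (simp only: GX, simp only: f_def X_def fst_conv snd_conv)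
  qed (use \<open>1 \<le> k\<close> in auto)
  also have "\<dots> = (\<Sum>i\<in>{1..n}. \<integral>\<omega>. f (X i \<omega>) * G (\<lambda>j\<in>J. X (h i j) \<omega>) \<partial>M)"
    by (intro Bochner_Integration.integral_sum leave_out(2) h' J)
  also have "\<dots> = (\<Sum>i\<in>{1..n}. \<pi>\<^sub>0 * t * (\<integral>\<omega>. G (\<lambda>j\<in>J. X j \<omega>) \<partial>M))"
  proof (rule sum.cong[OF refl])
    fix i assume "i \<in> {1..n}"
    from leave_out(1)[OF this h'[OF this] J]
    show "(\<integral>\<omega>. f (X i \<omega>) * G (\<lambda>j\<in>J. X (h i j) \<omega>) \<partial>M)
        = \<pi>\<^sub>0 * t * (\<integral>\<omega>. G (\<lambda>j\<in>J. X j \<omega>) \<partial>M)"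
      by (simp only: intf)
  qed
  also have "\<dots> = real n * \<pi>\<^sub>0 * t * (\<integral>\<omega>. G (\<lambda>j\<in>J. X j \<omega>) \<partial>M)"
    by simp
  \<comment> \<open>\<open>J\<close> is exactly the index range of the counts \<open>V\<close> and
    \<open>R\<close> at \<open>n - 1\<close>.\<close>
  also have "(\<lambda>\<omega>. G (\<lambda>j\<in>J. X j \<omega>)) =
      (\<lambda>\<omega>. of_bool (V p H (n - 1) t \<omega> \<ge> k - 1) / (real (R p (n - 1) t \<omega>) + 1))"
    unfolding G_def X_def V_def R_def J_def[symmetric]
    by (simp cong: sum.cong del: sum_of_bool_eq)
  finally show ?thesis .
qed

end
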